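(* Let $n\ge 2$, let $A$ be an $n\times n$ complex Hermitian matrix, and let $B$ be an $(n-1)\times(n-1)$ principal submatrix of $A$, i.e. the matrix obtained from $A$ by deleting the $i$-th row and the $i$-th column for some $i\in\{1,\dots,n\}$. Let $r_1\le r_2\le\dots\le r_n$ be the eigenvalues of $A$ and $s_1\le s_2\le\dots\le s_{n-1}$ the eigenvalues of $B$, each listed with multiplicity (all are real). Then the eigenvalues of $B$ interlace the eigenvalues of $A$, that is, $$ r_1 \le s_1 \le r_2 \le s_2 \le \cdots \le s_{n-1} \le r_n .$$
   Context: Two polynomials $f$ and $g$, of degrees $n$ and $n-1$, with all real roots $r_1\le r_2\le\dots\le r_n$ and $s_1\le s_2\le\dots\le s_{n-1}$ respectively (listed with multiplicity), are said to interlace if and only if $r_1\le s_1\le r_2\le s_2\le\cdots\le s_{n-1}\le r_n$. The eigenvalues of $B$ interlace those of $A$ when the characteristic polynomials of $A$ and $B$ interlace in this sense. *)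

theory Defs
  imports
    "HOL-Computational_Algebra.Polynomial"
    "Jordan_Normal_Form.Char_Poly"
    "Jordan_Normal_Form.Schur_Decomposition"
begin

definition hermitian_mat :: "complex mat \<Rightarrow> bool" where
  "hermitian_mat A \<longleftrightarrow> mat_adjoint A = A"

definition all_roots_real :: "complex poly \<Rightarrow> bool" where
  "all_roots_real f \<longleftrightarrow> (\<forall>z. poly f z = 0 \<longrightarrow> z \<in> \<real>)"

text \<open>
  The roots of a polynomial with only real roots, with multiplicity, in increasing order.
  When all roots are real, \<^const>\<open>Re\<close> merely changes the type of the roots. The indices
  start at 0, so the j-th smallest root is at position \<open>j - 1\<close>.
\<close>

definition sorted_real_roots :: "complex poly \<Rightarrow> real list" where
  "sorted_real_roots f = sorted_list_of_multiset (image_mset Re (proots f))"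

text \<open>
  The conditions on \<open>f\<close> and \<open>g\<close> exclude zero polynomials: \<^term>\<open>all_roots_real 0\<close> is false.
  Hence the two root lists have exactly \<^term>\<open>degree f\<close> and \<^term>\<open>degree g\<close> entries.
\<close>

definition interlace :: "complex poly \<Rightarrow> complex poly \<Rightarrow> bool" where
  "interlace f g \<longleftrightarrow>
     all_roots_real f \<and> all_roots_real g \<and> degree f = Suc (degree g) \<and>
     (\<forall>j < degree g.
        sorted_real_roots f ! j \<le> sorted_real_roots g ! j \<and>
        sorted_real_roots g ! j \<le> sorted_real_roots f ! Suc j)"

definition eigenvalues_interlace :: "complex mat \<Rightarrow> complex mat \<Rightarrow> bool" where
  "eigenvalues_interlace B A \<longleftrightarrow> interlace (char_poly A) (char_poly B)"

end

theory Submission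
  imports Defs
begin

text \<open>
  Diagonalize \<open>A\<close> and its compression \<open>B\<close> unitarily. If \<open>B\<close> had more eigenvalues \<open>\<le> t\<close> than \<open>A\<close>,
  then by counting dimensions some nonzero vector would lie both in the span of the eigenvectors of
  \<open>B\<close> for eigenvalues \<open>\<le> t\<close>, where the quadratic form is at most \<open>t \<bar>x\<bar>\<^sup>2\<close>, and in the span of those
  of \<open>A\<close> for eigenvalues \<open>> t\<close>, where it is larger: contradiction. With the two sides exchanged, \<open>A\<close> has at
  most one more eigenvalue \<open>\<le> t\<close> than \<open>B\<close>. Taking for \<open>t\<close> the eigenvalues themselves, these two
  comparisons of counting functions are exactly the interlacing inequalities.
\<close>

section \<open>Matrix adjoints and Hermitian congruence\<close>

lemma mat_adjoint_dim [simp]: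
  "dim_row (mat_adjoint A) = dim_col A" "dim_col (mat_adjoint A) = dim_row A"
  by (simp_all add: mat_adjoint_def)

lemma mat_adjoint_carrier [simp]:
  "A \<in> carrier_mat m n \<Longrightarrow> mat_adjoint A \<in> carrier_mat n m"
  by (intro carrier_matI) simp_all

lemma mat_adjoint_index [simp]:
  "i < dim_col A \<Longrightarrow> j < dim_row A \<Longrightarrow> mat_adjoint A $$ (i, j) = conjugate (A $$ (j, i))"
  by (simp add: mat_adjoint_def mat_of_rows_index)

lemma mat_adjoint_adjoint [simp]: "mat_adjoint (mat_adjoint A) = A"
  by (rule eq_matI) auto

lemma mat_adjoint_mult:
  assumes "A \<in> carrier_mat m n" "B \<in> carrier_mat n k"
  shows "mat_adjoint (A * B) = mat_adjoint B * mat_adjoint A"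
proof (rule eq_matI)
  fix i j assume "i < dim_row (mat_adjoint B * mat_adjoint A)" "j < dim_col (mat_adjoint B * mat_adjoint A)"
  with assms have ij: "i < k" "j < m" by auto
  have "mat_adjoint (A * B) $$ (i, j) = (\<Sum>l<n. conjugate (A $$ (j, l)) * conjugate (B $$ (l, i)))"
    using assms ij by (simp add: scalar_prod_def atLeast0LessThan sum_conjugate conjugate_dist_mul)
  also have "\<dots> = (mat_adjoint B * mat_adjoint A) $$ (i, j)"
    using assms ij by (simp add: scalar_prod_def atLeast0LessThan mult.commute)
  finally show "mat_adjoint (A * B) $$ (i, j) = (mat_adjoint B * mat_adjoint A) $$ (i, j)" .
qed (use assms in auto)

lemma mat_adjoint_scalar_prod:
  assumes "A \<in> carrier_mat m n" "y \<in> carrier_vec n" "x \<in> carrier_vec m"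
  shows "(A *\<^sub>v y) \<bullet>c x = y \<bullet>c (mat_adjoint A *\<^sub>v x)"
proof -
  have "(A *\<^sub>v y) \<bullet>c x = (\<Sum>i<m. \<Sum>j<n. A $$ (i, j) * y $ j * conjugate (x $ i))"
    using assms by (auto simp: scalar_prod_def sum_distrib_right atLeast0LessThan intro!: sum.cong)
  also have "\<dots> = (\<Sum>j<n. \<Sum>i<m. A $$ (i, j) * y $ j * conjugate (x $ i))"
    by (rule sum.swap)
  also have "\<dots> = y \<bullet>c (mat_adjoint A *\<^sub>v x)"
    using assms
    by (auto simp: scalar_prod_def sum_distrib_left atLeast0LessThan sum_conjugate conjugate_dist_mul
        mult_ac intro!: sum.cong)
  finally show ?thesis .
qed

lemma hermitian_mat_congruence:
  assumes "hermitian_mat A" "A \<in> carrier_mat n n" "U \<in> carrier_mat n m"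
  shows "hermitian_mat (mat_adjoint U * A * U)"
proof -
  have "mat_adjoint (mat_adjoint U * A * U) = mat_adjoint U * mat_adjoint (mat_adjoint U * A)"
    using assms by (intro mat_adjoint_mult[of _ m n _ m]) auto
  also have "mat_adjoint (mat_adjoint U * A) = A * U"
    using assms by (subst mat_adjoint_mult[of _ m n _ n]) (auto simp: hermitian_mat_def)
  also have "mat_adjoint U * (A * U) = mat_adjoint U * A * U"
    using assms by (intro assoc_mult_mat[symmetric, of _ m n _ n _ m]) auto
  finally show ?thesis by (simp add: hermitian_mat_def)
qed

section \<open>Unitary diagonalization of Hermitian matrices\<close>

text \<open>Complete \<open>v\<close> to a basis, orthogonalize by Gram-Schmidt, which keeps the
  first vector, and normalize. The scalar \<open>c\<close> is the normalizing factor of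
  \<open>v\<close>.\<close>

lemma unitary_extending_vec:
  fixes v :: "complex vec"
  assumes v: "v \<in> carrier_vec n" and v0: "v \<noteq> 0\<^sub>v n" and n: "n \<noteq> 0"
  obtains W c where "W \<in> carrier_mat n n" "mat_adjoint W * W = 1\<^sub>m n" "col W 0 = c \<cdot>\<^sub>v v"
proof -
  interpret cof_vec_space n "TYPE(complex)" .
  define b where "b = basis_completion v"
  define ws where "ws = gram_schmidt n b"
  from basis_completion[OF v v0, folded b_def]
  have dist_b: "distinct b" and indep: "\<not> lin_dep (set b)" and b: "set b \<subseteq> carrier_vec n"
    and hdb: "hd b = v" and len_b: "length b = n" by auto
  from hdb len_b n obtain vs where bv: "b = v # vs" by (cases b) auto
  from gram_schmidt_result[OF b dist_b indep refl, folded ws_def]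
  have ws: "set ws \<subseteq> carrier_vec n" "corthogonal ws" "length ws = n"
    by (auto simp: len_b)
  from gram_schmidt_hd[OF v, of vs, folded bv] have hdws: "hd ws = v" unfolding ws_def .
  define r where "r w = complex_of_real (1 / sqrt (Re (w \<bullet>c w)))" for w :: "complex vec"
  define W where "W = mat_of_cols n (map (\<lambda>w. r w \<cdot>\<^sub>v w) ws)"
  have W: "W \<in> carrier_mat n n"
    using mat_of_cols_carrier(1)[of n "map (\<lambda>w. r w \<cdot>\<^sub>v w) ws"] ws(3) by (simp add: W_def)
  have wsc: "ws ! i \<in> carrier_vec n" if "i < n" for i
    using ws that by auto
  have colW: "col W i = r (ws ! i) \<cdot>\<^sub>v ws ! i" if "i < n" for i
    unfolding W_def using that ws wsc by (subst col_mat_of_cols) auto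
  have norm: "cnj (r (ws ! i)) * (r (ws ! i) * (ws ! i \<bullet>c ws ! i)) = 1" if i: "i < n" for i
  proof -
    have ne: "ws ! i \<bullet>c ws ! i \<noteq> 0"
      using ws(2,3) i corthogonalD by blast
    \<comment> \<open>Complex numbers are comparable only if their imaginary parts agree, so this
      also says that the squared norm is real.\<close>
    have ge: "ws ! i \<bullet>c ws ! i \<ge> 0" by blast
    define a where "a = Re (ws ! i \<bullet>c ws ! i)"
    have a: "ws ! i \<bullet>c ws ! i = complex_of_real a"
      using ge by (simp add: a_def complex_eq_iff less_eq_complex_def)
    have apos: "a > 0" using ne ge unfolding a by (simp add: less_eq_complex_def)
    then have "1 / sqrt a * (1 / sqrt a * a) = 1"
      by (simp add: field_simps)
    then show ?thesis
      unfolding r_def a by (simp flip: of_real_mult)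
  qed
  have unit: "mat_adjoint W * W = 1\<^sub>m n"
  proof (rule eq_matI)
    fix i j assume "i < dim_row (1\<^sub>m n :: complex mat)" "j < dim_col (1\<^sub>m n :: complex mat)"
    then have i: "i < n" and j: "j < n" by auto
    have "(mat_adjoint W * W) $$ (i, j) = conjugate (col W i) \<bullet> col W j"
      using W i j by (simp add: mat_adjoint_def)
    also have "\<dots> = cnj (r (ws ! i)) * (r (ws ! j) * (ws ! j \<bullet>c ws ! i))"
      using wsc[OF i] wsc[OF j] unfolding colW[OF i] colW[OF j]
      by (simp add: conjugate_smult_vec conjugate_vec_sprod_comm)
    also have "\<dots> = 1\<^sub>m n $$ (i, j)"
      using norm[OF i] corthogonalD[OF ws(2), of j i] i j ws(3) by auto
    finally show "(mat_adjoint W * W) $$ (i, j) = 1\<^sub>m n $$ (i, j)" .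
  qed (use W in auto)
  have "ws ! 0 = v" using hdws ws(3) n by (cases ws) auto
  with colW[of 0] n have "col W 0 = r v \<cdot>\<^sub>v v" by simp
  with W unit show thesis by (rule that)
qed

lemma hermitian_mat_index:
  assumes "hermitian_mat A" "A \<in> carrier_mat n n" "i < n" "j < n"
  shows "A $$ (i, j) = cnj (A $$ (j, i))"
  using assms mat_adjoint_index[of i A j] by (simp add: hermitian_mat_def)

text \<open>Deflation, by induction on the list of roots. In an orthonormal basis that starts with
  an eigenvector for the first root, the matrix splits into a 1 by 1 block and a smaller Hermitian
  block, whose characteristic polynomial has the remaining roots. The diagonal thus comes out in the
  order prescribed by \<open>as\<close>.\<close>

theorem hermitian_spectral_decomposition:
  assumes "A \<in> carrier_mat n n" "hermitian_mat A"
    and "char_poly A = (\<Prod>a\<leftarrow>as. [:- a, 1:])"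
  shows "\<exists>U \<in> carrier_mat n n. mat_adjoint U * U = 1\<^sub>m n \<and>
           mat_adjoint U * A * U = mat_diag n (\<lambda>k. as ! k)"
  using assms
proof (induction as arbitrary: n A)
  case Nil
  then have "n = 0" using degree_monic_char_poly[of A n] by auto
  then show ?case
    using Nil.prems by (intro bexI[of _ "1\<^sub>m n"]) (auto simp: mat_diag_def intro!: eq_matI)
next
  case (Cons e as)
  note A = Cons.prems(1) and herm = Cons.prems(2)
  have cp: "char_poly A = [:- e, 1:] * (\<Prod>a\<leftarrow>as. [:- a, 1:])"
    using Cons.prems(3) by simp
  have root: "poly (char_poly A) e = 0" by (simp add: cp)
  have "n \<noteq> 0"
  proof
    assume "n = 0"
    then have "char_poly A = 1"
      using degree_monic_char_poly[OF A] by (metis monic_degree_0)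
    with root show False by simp
  qed
  then obtain m where n: "n = Suc m" by (cases n) auto
  obtain v where v: "v \<in> carrier_vec n" "v \<noteq> 0\<^sub>v n" "A *\<^sub>v v = e \<cdot>\<^sub>v v"
    using root A unfolding eigenvalue_root_char_poly[OF A, symmetric] eigenvalue_def eigenvector_def
    by auto
  obtain W c where W: "W \<in> carrier_mat n n" "mat_adjoint W * W = 1\<^sub>m n" "col W 0 = c \<cdot>\<^sub>v v"
    using unitary_extending_vec[OF v(1,2)] n by blast
  have aW: "mat_adjoint W \<in> carrier_mat n n" using W(1) by simp
  define M where "M = mat_adjoint W * A * W"
  have M: "M \<in> carrier_mat n n" and M_herm: "hermitian_mat M"
    using A W herm hermitian_mat_congruence[OF herm A W(1)] unfolding M_def by auto
  have "W * mat_adjoint W = 1\<^sub>m n"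
    using mat_mult_left_right_inverse W by (metis mat_adjoint_carrier)
  then have "similar_mat_wit M A (mat_adjoint W) W"
    using A W M by (intro similar_mat_witI[of _ _ n]) (auto simp: M_def)
  then have cpM: "char_poly M = char_poly A"
    by (intro char_poly_similar) (auto simp: similar_mat_def)
  have "A *\<^sub>v col W 0 = e \<cdot>\<^sub>v col W 0"
    using A v by (simp add: W(3) mult_mat_vec smult_smult_assoc mult.commute)
  moreover have "col M 0 = mat_adjoint W *\<^sub>v (A *\<^sub>v col W 0)"
  proof -
    have "M = mat_adjoint W * (A * W)"
      unfolding M_def by (rule assoc_mult_mat[OF aW A W(1)])
    moreover have "col (A * W) 0 = A *\<^sub>v col W 0"
      using n by (intro col_mult2[OF A W(1)]) simp
    moreover have "col (mat_adjoint W * (A * W)) 0 = mat_adjoint W *\<^sub>v col (A * W) 0"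
      using n by (intro col_mult2[OF aW mult_carrier_mat[OF A W(1)]]) simp
    ultimately show ?thesis by (simp only:)
  qed
  moreover have "col W 0 \<in> carrier_vec n"
    using W(3) v(1) by simp
  ultimately have "col M 0 = e \<cdot>\<^sub>v (mat_adjoint W *\<^sub>v col W 0)"
    using W(1) by (simp add: mult_mat_vec[of _ n n])
  also have "mat_adjoint W *\<^sub>v col W 0 = col (1\<^sub>m n) 0"
    using W n by (metis col_mult2 mat_adjoint_carrier zero_less_Suc)
  finally have col0: "col M 0 = e \<cdot>\<^sub>v unit_vec n 0" using n by simp
  have M0: "M $$ (i, 0) = (if i = 0 then e else 0)" if "i < n" for i
    using that arg_cong[OF col0, of "\<lambda>v. v $ i"] M n by (auto simp: unit_vec_def)
  \<comment> \<open>Hermitian symmetry carries the zeros of the first column over to the first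
    row.\<close>
  have M0': "M $$ (0, i) = (if i = 0 then e else 0)" if "i < n" for i
  proof (cases "i = 0")
    case False
    then show ?thesis
      using hermitian_mat_index[OF M_herm M, of 0 i] M0[OF that] that n by simp
  qed (use M0[OF that] that in auto)
  define D where "D = mat m m (\<lambda>(i, j). M $$ (Suc i, Suc j))"
  have D: "D \<in> carrier_mat m m" by (simp add: D_def)
  let ?e = "mat 1 1 (\<lambda>_. e)"
  have M_block: "M = four_block_mat ?e (0\<^sub>m 1 m) (0\<^sub>m m 1) D"
    using M n by (intro eq_matI) (auto simp: D_def M0 M0')
  have "mat_adjoint D $$ (i, j) = D $$ (i, j)" if "i < m" "j < m" for i j
    using hermitian_mat_index[OF M_herm M, of "Suc i" "Suc j", symmetric] that n
    by (simp add: D_def)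
  then have "hermitian_mat D"
    unfolding hermitian_mat_def using D by (intro eq_matI) auto
  moreover have "char_poly M = [:- e, 1:] * char_poly D"
    unfolding M_block
    by (subst char_poly_four_block_zeros_col[of _ _ m])
       (auto simp: D char_poly_defs det_def sign_def)
  \<comment> \<open>\<open>M\<close> is similar to \<open>A\<close>, so the linear factor of
    \<open>e\<close> cancels from two factorizations of one polynomial.\<close>
  then have "char_poly D = (\<Prod>a\<leftarrow>as. [:- a, 1:])"
    using cp cpM by (metis mult_cancel_left pCons_eq_0_iff zero_neq_one)
  ultimately obtain V where V: "V \<in> carrier_mat m m" "mat_adjoint V * V = 1\<^sub>m m"
      "mat_adjoint V * D * V = mat_diag m (\<lambda>k. as ! k)"
    using Cons.IH[OF D] by blast
  \<comment> \<open>Bordering \<open>V\<close> by 1 leaves the eigenvector for \<open>e\<close> in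
    place; the diagonalizing unitary for \<open>A\<close> is \<open>W * X\<close>.\<close>
  define X where "X = four_block_mat (1\<^sub>m 1) (0\<^sub>m 1 m) (0\<^sub>m m 1) V"
  have X: "X \<in> carrier_mat n n" using V n unfolding X_def by auto
  have adjX: "mat_adjoint X = four_block_mat (1\<^sub>m 1) (0\<^sub>m 1 m) (0\<^sub>m m 1) (mat_adjoint V)"
    using V(1) unfolding X_def by (intro eq_matI) auto
  have "mat_adjoint X * X = four_block_mat (1\<^sub>m 1) (0\<^sub>m 1 m) (0\<^sub>m m 1) (1\<^sub>m m)"
    unfolding adjX unfolding X_def using V
    by (subst mult_four_block_mat[of _ 1 1 _ m _ m _ _ 1 _ m]) auto
  then have XX: "mat_adjoint X * X = 1\<^sub>m n" using n by auto
  have "mat_adjoint X * M = four_block_mat ?e (0\<^sub>m 1 m) (0\<^sub>m m 1) (mat_adjoint V * D)"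
    unfolding adjX unfolding M_block using V(1) D
    by (subst mult_four_block_mat[of _ 1 1 _ m _ m _ _ 1 _ m]) auto
  then have "mat_adjoint X * M * X =
      four_block_mat ?e (0\<^sub>m 1 m) (0\<^sub>m m 1) (mat_diag m (\<lambda>k. as ! k))"
    unfolding X_def V(3)[symmetric] using V(1) D mult_carrier_mat[of "mat_adjoint V" m m D m]
    by (simp, subst mult_four_block_mat[of _ 1 1 _ m _ m _ _ 1 _ m]) auto
  also have "\<dots> = mat_diag n (\<lambda>k. (e # as) ! k)"
    using n by (intro eq_matI) (auto simp: mat_diag_def)
  finally have XMX: "mat_adjoint X * M * X = mat_diag n (\<lambda>k. (e # as) ! k)" .
  have adj: "mat_adjoint (W * X) = mat_adjoint X * mat_adjoint W"
    using mat_adjoint_mult W(1) X by blast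
  have aX: "mat_adjoint X \<in> carrier_mat n n" using X by simp
  note assoc = assoc_mult_mat[of _ n n _ n _ n] and carr = mult_carrier_mat[of _ n n _ n]
  have "mat_adjoint (W * X) * (W * X) = mat_adjoint X * (mat_adjoint W * W) * X"
    unfolding adj using W(1) X aW aX by (simp add: assoc carr)
  then have "mat_adjoint (W * X) * (W * X) = 1\<^sub>m n"
    by (simp only: W(2) right_mult_one_mat[OF aX] XX)
  moreover have "mat_adjoint (W * X) * A * (W * X) = mat_adjoint X * M * X"
    unfolding adj M_def using W(1) X aW aX A by (simp add: assoc carr)
  then have "mat_adjoint (W * X) * A * (W * X) = mat_diag n (\<lambda>k. (e # as) ! k)"
    by (simp only: XMX)
  ultimately show ?case
    using carr[OF W(1) X] by blast
qed

section \<open>Quadratic forms under compression and the comparison of eigenvalue counts\<close>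

text \<open>Padding the system with zero rows gives a square matrix with at least one zero row,
  hence a singular one.\<close>

lemma underdetermined_system:
  fixes rs :: "'a :: field vec list"
  assumes "set rs \<subseteq> carrier_vec m" "length rs < m"
  obtains v where "v \<in> carrier_vec m" "v \<noteq> 0\<^sub>v m" "\<And>r. r \<in> set rs \<Longrightarrow> r \<bullet> v = 0"
proof -
  define M where "M = mat m m (\<lambda>(i, j). if i < length rs then rs ! i $ j else 0)"
  have M: "M \<in> carrier_mat m m" by (simp add: M_def)
  \<comment> \<open>The product is the last row of \<open>M\<close>, which is padding because
    \<open>length rs < m\<close>.\<close>
  have "transpose_mat M *\<^sub>v unit_vec m (m - 1) = 0\<^sub>v m"
    using assms(2) by (intro eq_vecI) (auto simp: M_def)
  moreover have "unit_vec m (m - 1) \<noteq> (0\<^sub>v m :: 'a vec)"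
    using assms(2) by (metis diff_less index_unit_vec(2) index_zero_vec(1) less_nat_zero_code not_gr_zero
        zero_less_one zero_neq_one)
  ultimately have "det (transpose_mat M) = 0"
    using M by (subst det_0_iff_vec_prod_zero_field[of _ m]) (auto intro!: exI[of _ "unit_vec m (m - 1)"])
  then have "det M = 0" using det_transpose[OF M] by simp
  then obtain v where v: "v \<in> carrier_vec m" "v \<noteq> 0\<^sub>v m" "M *\<^sub>v v = 0\<^sub>v m"
    using det_0_iff_vec_prod_zero_field[OF M] by auto
  have "r \<bullet> v = 0" if r: "r \<in> set rs" for r
  proof -
    obtain i where i: "i < length rs" "r = rs ! i" using r by (auto simp: in_set_conv_nth)
    have "r \<in> carrier_vec m" using r assms(1) by auto
    then have "row M i = r" using i assms(2) by (intro eq_vecI) (auto simp: M_def)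
    then show ?thesis using arg_cong[OF v(3), of "\<lambda>w. w $ i"] i assms(2) M by auto
  qed
  with v that show thesis by blast
qed

text \<open>The entries of \<open>d\<close> are the coordinates of \<open>x\<close> in the
  orthonormal eigenbasis formed by the columns of \<open>U\<close>; there the norm is a plain sum of
  squares and the form a weighted one.\<close>

lemma diagonalized_quadratic_form:
  fixes A :: "complex mat"
  assumes A: "A \<in> carrier_mat n n" and U: "U \<in> carrier_mat n n" "mat_adjoint U * U = 1\<^sub>m n"
    and diag: "mat_adjoint U * A * U = mat_diag n f" and x: "x \<in> carrier_vec n"
  defines "d \<equiv> mat_adjoint U *\<^sub>v x"
  shows "Re (x \<bullet>c x) = (\<Sum>k<n. (cmod (d $ k))\<^sup>2)"
    and "Re ((A *\<^sub>v x) \<bullet>c x) = (\<Sum>k<n. Re (f k) * (cmod (d $ k))\<^sup>2)"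
proof -
  have aU: "mat_adjoint U \<in> carrier_mat n n" and d: "d \<in> carrier_vec n"
    using U mult_mat_vec_carrier[of "mat_adjoint U" n n x] x by (auto simp: d_def)
  have "U * mat_adjoint U = 1\<^sub>m n"
    using mat_mult_left_right_inverse[OF aU U(1) U(2)] .
  then have Ud: "U *\<^sub>v d = x"
    using U(1) aU x unfolding d_def by (metis assoc_mult_mat_vec one_mult_mat_vec)
  have form: "y \<bullet>c x = (mat_adjoint U *\<^sub>v y) \<bullet>c d" if "y \<in> carrier_vec n" for y
    using mat_adjoint_scalar_prod[OF aU that d] Ud by simp
  have "Re (x \<bullet>c x) = Re (d \<bullet>c d)"
    using form[OF x] by (simp add: d_def)
  also have "\<dots> = (\<Sum>k<n. (cmod (d $ k))\<^sup>2)"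
    using d by (auto simp: scalar_prod_def atLeast0LessThan complex_mult_cnj cmod_power2 intro!: sum.cong)
  finally show "Re (x \<bullet>c x) = (\<Sum>k<n. (cmod (d $ k))\<^sup>2)" .
  have "mat_adjoint U *\<^sub>v (A *\<^sub>v x) = mat_adjoint U * A * U *\<^sub>v d"
    using U aU A d x Ud by (metis assoc_mult_mat_vec mult_carrier_mat)
  then have Ax: "mat_adjoint U *\<^sub>v (A *\<^sub>v x) = mat_diag n f *\<^sub>v d"
    by (simp add: diag)
  have "(mat_diag n f *\<^sub>v d) $ k = f k * d $ k" if "k < n" for k
    using that d by (simp add: mat_diag_def scalar_prod_def if_distrib if_distribR sum.delta cong: if_cong)
  then have "(A *\<^sub>v x) \<bullet>c x = (\<Sum>k<n. f k * d $ k * cnj (d $ k))"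
    using d A x by (simp add: form Ax)
      (auto simp: scalar_prod_def atLeast0LessThan intro!: sum.cong)
  also have "\<dots> = (\<Sum>k<n. f k * complex_of_real ((cmod (d $ k))\<^sup>2))"
    by (simp only: complex_norm_square mult.assoc)
  finally show "Re ((A *\<^sub>v x) \<bullet>c x) = (\<Sum>k<n. Re (f k) * (cmod (d $ k))\<^sup>2)"
    by simp
qed

text \<open>
  The weights are the squared moduli of the coordinates of a single nonzero vector with respect to
  both eigenbases; it exists because it is subject to fewer than \<open>m\<close> linear conditions.
\<close>

lemma compression_weights:
  fixes A E :: "complex mat"
  assumes A: "A \<in> carrier_mat n n" and E: "E \<in> carrier_mat n m" "mat_adjoint E * E = 1\<^sub>m m"
    and U: "U \<in> carrier_mat n n" "mat_adjoint U * U = 1\<^sub>m n" "mat_adjoint U * A * U = mat_diag n f"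
    and V: "V \<in> carrier_mat m m" "mat_adjoint V * V = 1\<^sub>m m"
      "mat_adjoint V * (mat_adjoint E * A * E) * V = mat_diag m g"
    and card: "card {k. k < n \<and> P k} + card {k. k < m \<and> Q k} < m"
  obtains p q :: "nat \<Rightarrow> real"
  where "\<And>k. p k \<ge> 0" "\<And>k. q k \<ge> 0"
    "\<And>k. k < n \<Longrightarrow> P k \<Longrightarrow> p k = 0" "\<And>k. k < m \<Longrightarrow> Q k \<Longrightarrow> q k = 0"
    "(\<Sum>k<n. p k) = (\<Sum>k<m. q k)" "(\<Sum>k<n. p k) > 0"
    "(\<Sum>k<n. Re (f k) * p k) = (\<Sum>k<m. Re (g k) * q k)"
proof -
  define B where "B = mat_adjoint E * A * E"
  have aU: "mat_adjoint U \<in> carrier_mat n n" and aV: "mat_adjoint V \<in> carrier_mat m m"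
    and aE: "mat_adjoint E \<in> carrier_mat m n" using U V E by auto
  have B: "B \<in> carrier_mat m m" using A aE E unfolding B_def by auto
  \<comment> \<open>The conditions on \<open>y\<close>: the coordinates of
    \<open>E *\<^sub>v y\<close> in the eigenbasis of \<open>A\<close> vanish at the indices in
    \<open>P\<close>, and those of \<open>y\<close> in the eigenbasis of the compression vanish at
    the indices in \<open>Q\<close>.\<close>
  define rs where "rs = map (row (mat_adjoint U * E)) (filter P [0..<n]) @
    map (row (mat_adjoint V)) (filter Q [0..<m])"
  have "set rs \<subseteq> carrier_vec m"
    using aU aV E by (auto simp: rs_def)
  moreover have "length rs < m"
    using card by (simp add: rs_def length_filter_conv_card cong: conj_cong)
  ultimately obtain y where y: "y \<in> carrier_vec m" "y \<noteq> 0\<^sub>v m" and rs0: "\<And>r. r \<in> set rs \<Longrightarrow> r \<bullet> y = 0"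
    using underdetermined_system[of rs m] by blast
  \<comment> \<open>Since \<open>E\<close> is an isometry, \<open>x\<close> has the norm of
    \<open>y\<close>, and the form of \<open>A\<close> at \<open>x\<close> is the form of the
    compression at \<open>y\<close>.\<close>
  define x where "x = E *\<^sub>v y"
  have x: "x \<in> carrier_vec n" using E y by (auto simp: x_def)
  define p where "p k = (cmod ((mat_adjoint U *\<^sub>v x) $ k))\<^sup>2" for k
  define q where "q k = (cmod ((mat_adjoint V *\<^sub>v y) $ k))\<^sup>2" for k
  have Ux: "mat_adjoint U *\<^sub>v x = mat_adjoint U * E *\<^sub>v y"
    using aU E y by (simp add: x_def)
  have p0: "p k = 0" if "k < n" "P k" for k
    using rs0[of "row (mat_adjoint U * E) k"] that U by (auto simp: p_def Ux rs_def)
  have q0: "q k = 0" if "k < m" "Q k" for k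
    using rs0[of "row (mat_adjoint V) k"] that V by (auto simp: q_def rs_def)
  have form: "z \<bullet>c x = (mat_adjoint E *\<^sub>v z) \<bullet>c y" if "z \<in> carrier_vec n" for z
    using mat_adjoint_scalar_prod[OF aE that y(1)] by (simp add: x_def)
  have "mat_adjoint E *\<^sub>v x = y"
    using aE E y unfolding x_def by (metis assoc_mult_mat_vec one_mult_mat_vec)
  then have xx: "x \<bullet>c x = y \<bullet>c y" using form[OF x] by simp
  have "B *\<^sub>v y = mat_adjoint E * A *\<^sub>v x"
    unfolding B_def x_def by (rule assoc_mult_mat_vec[OF mult_carrier_mat[OF aE A] E(1) y(1)])
  also have "\<dots> = mat_adjoint E *\<^sub>v (A *\<^sub>v x)"
    by (rule assoc_mult_mat_vec[OF aE A x])
  finally have "mat_adjoint E *\<^sub>v (A *\<^sub>v x) = B *\<^sub>v y" ..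
  then have Ax: "(A *\<^sub>v x) \<bullet>c x = (B *\<^sub>v y) \<bullet>c y"
    using form[of "A *\<^sub>v x"] A x by simp
  note formA = diagonalized_quadratic_form[OF A U x, folded p_def]
  note formB = diagonalized_quadratic_form[OF B V(1,2) V(3)[folded B_def] y(1), folded q_def]
  have "y \<bullet>c y > 0" using y by simp
  then have "Re (y \<bullet>c y) > 0" by (simp add: less_complex_def)
  then show thesis
    using p0 q0 formA formB xx Ax by (intro that[of p q]) (simp_all add: p_def q_def)
qed

text \<open>If either bound failed, \<open>compression_weights\<close> would give equal sums of
  \<open>(eigenvalue - t) * weight\<close> on the two sides, one of them positive and the other at
  most 0. The second bound is additive to avoid truncated subtraction on naturals.\<close>

lemma compression_eigenvalue_count:
  fixes A E :: "complex mat"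
  assumes A: "A \<in> carrier_mat n n" and E: "E \<in> carrier_mat n m" "mat_adjoint E * E = 1\<^sub>m m"
    and U: "U \<in> carrier_mat n n" "mat_adjoint U * U = 1\<^sub>m n" "mat_adjoint U * A * U = mat_diag n f"
    and V: "V \<in> carrier_mat m m" "mat_adjoint V * V = 1\<^sub>m m"
      "mat_adjoint V * (mat_adjoint E * A * E) * V = mat_diag m g"
  shows "card {k. k < m \<and> Re (g k) \<le> t} \<le> card {k. k < n \<and> Re (f k) \<le> t}" (is "?G \<le> ?F")
    and "card {k. k < n \<and> Re (f k) \<le> t} + m \<le> card {k. k < m \<and> Re (g k) \<le> t} + n"
proof -
  have compl: "card {k. k < l \<and> \<not> R k} = l - card {k. k < l \<and> R k}" "card {k. k < l \<and> R k} \<le> l"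
    for l :: nat and R
  proof -
    have "{k. k < l \<and> \<not> R k} = {..<l} - {k. k < l \<and> R k}" by auto
    then show "card {k. k < l \<and> \<not> R k} = l - card {k. k < l \<and> R k}"
      by (simp add: card_Diff_subset subset_iff)
    show "card {k. k < l \<and> R k} \<le> l"
      using card_mono[of "{..<l}" "{k. k < l \<and> R k}"] by auto
  qed
  have shift: "(\<Sum>k<l. (h k - t) * w k) = (\<Sum>k<l. h k * w k) - t * (\<Sum>k<l. w k)"
    for l and h w :: "nat \<Rightarrow> real"
    by (simp add: algebra_simps sum_subtractf sum_distrib_left)
  have pos: "(\<Sum>k<l. (h k - t) * w k) > 0"
    if w: "\<And>k. w k \<ge> 0" "(\<Sum>k<l. w k) > 0" "\<And>k. k < l \<Longrightarrow> h k \<le> t \<Longrightarrow> w k = 0"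
    for l and h w :: "nat \<Rightarrow> real"
  proof -
    have nn: "(h k - t) * w k \<ge> 0" if "k < l" for k
      using w(1)[of k] w(3)[OF that] by (cases "h k \<le> t") auto
    \<comment> \<open>A positive total forces some nonzero weight, which can only sit at a value
      above \<open>t\<close>; this makes the inequality strict.\<close>
    obtain k where k: "k < l" "w k \<noteq> 0"
      using w(2) by (metis lessThan_iff less_irrefl sum.neutral)
    moreover have "h k > t" using k w(3)[of k] by (meson not_le)
    ultimately have "(h k - t) * w k > 0"
      using w(1)[of k] by (intro mult_pos_pos) (auto simp: order_le_less)
    with k nn show ?thesis by (intro sum_pos2[of _ k]) auto
  qed
  have neg: "(\<Sum>k<l. (h k - t) * w k) \<le> 0"
    if "\<And>k. w k \<ge> 0" "\<And>k. k < l \<Longrightarrow> \<not> h k \<le> t \<Longrightarrow> w k = 0"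
    for l and h w :: "nat \<Rightarrow> real"
  proof (rule sum_nonpos)
    fix k assume "k \<in> {..<l}"
    with that(1)[of k] that(2)[of k] show "(h k - t) * w k \<le> 0"
      by (cases "h k \<le> t") (auto simp: mult_nonpos_nonneg)
  qed
  show "?G \<le> ?F"
  proof (rule ccontr)
    assume "\<not> ?G \<le> ?F"
    \<comment> \<open>Weights are killed at the eigenvalues of \<open>A\<close> up to
      \<open>t\<close> and at those of the compression above \<open>t\<close>; there are
      \<open>?F + (m - ?G)\<close> such conditions.\<close>
    then have card: "card {k. k < n \<and> Re (f k) \<le> t} + card {k. k < m \<and> \<not> Re (g k) \<le> t} < m"
      using compl[of m "\<lambda>k. Re (g k) \<le> t"] by linarith
    show False
    proof (rule compression_weights[OF A E U V card])
      fix p q :: "nat \<Rightarrow> real"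
      assume pq: "\<And>k. p k \<ge> 0" "\<And>k. q k \<ge> 0" "\<And>k. k < n \<Longrightarrow> Re (f k) \<le> t \<Longrightarrow> p k = 0"
        "\<And>k. k < m \<Longrightarrow> \<not> Re (g k) \<le> t \<Longrightarrow> q k = 0"
        "(\<Sum>k<n. p k) = (\<Sum>k<m. q k)" "(\<Sum>k<n. p k) > 0"
        "(\<Sum>k<n. Re (f k) * p k) = (\<Sum>k<m. Re (g k) * q k)"
      have "(\<Sum>k<n. (Re (f k) - t) * p k) > 0"
        using pq by (intro pos) auto
      moreover have "(\<Sum>k<m. (Re (g k) - t) * q k) \<le> 0"
        using pq by (intro neg) auto
      ultimately show False using pq(5,7) by (simp add: shift)
    qed
  qed
  show "?F + m \<le> ?G + n"
  proof (rule ccontr)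
    assume "\<not> ?F + m \<le> ?G + n"
    \<comment> \<open>Now the roles are exchanged, with \<open>(n - ?F) + ?G\<close>
      conditions.\<close>
    then have card: "card {k. k < n \<and> \<not> Re (f k) \<le> t} + card {k. k < m \<and> Re (g k) \<le> t} < m"
      using compl[of n "\<lambda>k. Re (f k) \<le> t"] by linarith
    show False
    proof (rule compression_weights[OF A E U V card])
      fix p q :: "nat \<Rightarrow> real"
      assume pq: "\<And>k. p k \<ge> 0" "\<And>k. q k \<ge> 0" "\<And>k. k < n \<Longrightarrow> \<not> Re (f k) \<le> t \<Longrightarrow> p k = 0"
        "\<And>k. k < m \<Longrightarrow> Re (g k) \<le> t \<Longrightarrow> q k = 0"
        "(\<Sum>k<n. p k) = (\<Sum>k<m. q k)" "(\<Sum>k<n. p k) > 0"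
        "(\<Sum>k<n. Re (f k) * p k) = (\<Sum>k<m. Re (g k) * q k)"
      have "(\<Sum>k<n. (Re (f k) - t) * p k) \<le> 0"
        using pq by (intro neg) auto
      moreover have "(\<Sum>k<m. (Re (g k) - t) * q k) > 0"
        using pq by (intro pos) auto
      ultimately show False using pq(5,7) by (simp add: shift)
    qed
  qed
qed

section \<open>Sorted root lists, counting functions and reality of the roots\<close>

text \<open>In a sorted list the entries up to \<open>t\<close> form an initial segment. This turns
  inequalities between order statistics into inequalities between counts.\<close>

lemma sorted_nth_le_iff:
  fixes xs :: "'a :: linorder list"
  assumes "sorted xs" "j < length xs"
  shows "xs ! j \<le> t \<longleftrightarrow> j < length (filter (\<lambda>x. x \<le> t) xs)"
  using assms
proof (induction xs arbitrary: j)
  case (Cons x xs)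
  show ?case
  proof (cases "x \<le> t")
    case True
    with Cons show ?thesis by (cases j) auto
  next
    case False
    then have gt: "t < y" if "y \<in> set (x # xs)" for y
      using that Cons.prems(1) by auto
    then have "filter (\<lambda>x. x \<le> t) (x # xs) = []"
      by (force simp: filter_empty_conv)
    moreover have "t < (x # xs) ! j"
      using gt Cons.prems(2) nth_mem by blast
    ultimately show ?thesis by auto
  qed
qed simp

lemma proots_prod_linear_factors: "proots (\<Prod>a\<leftarrow>as. [:- a, 1:]) = mset (as :: 'a :: idom list)"
proof (induction as)
  case (Cons a as)
  \<comment> \<open>Root multisets add under multiplication only for nonzero factors.\<close>
  have "(\<Prod>a\<leftarrow>as. [:- a, 1:]) \<noteq> 0" by (auto simp: prod_list_zero_iff)
  with Cons show ?case by (simp add: proots_mult del: mult_pCons_left)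
qed simp

lemma sorted_real_roots_linear_factors:
  "sorted_real_roots (\<Prod>a\<leftarrow>as. [:- a, 1:]) = sort (map Re as)"
  by (simp add: sorted_real_roots_def proots_prod_linear_factors flip: mset_map)

lemma sorted_nth_le_iff_card:
  fixes as :: "complex list"
  assumes "j < length as"
  shows "sort (map Re as) ! j \<le> t \<longleftrightarrow> j < card {k. k < length as \<and> Re (as ! k) \<le> t}"
proof -
  have "length (filter (\<lambda>x. x \<le> t) (sort (map Re as))) = length (filter (\<lambda>x. x \<le> t) (map Re as))"
    by (metis mset_filter mset_sort size_mset)
  also have "\<dots> = card {k. k < length as \<and> Re (as ! k) \<le> t}"
    by (auto simp: length_filter_conv_card intro!: arg_cong[of _ _ card])
  finally show ?thesis using assms by (simp add: sorted_nth_le_iff)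
qed

text \<open>The unitarily diagonalized matrix is again Hermitian, so its diagonal entries, which are
  the roots, equal their own conjugates.\<close>

lemma all_roots_real_hermitian:
  assumes A: "A \<in> carrier_mat n n" and herm: "hermitian_mat A"
  shows "all_roots_real (char_poly A)"
proof -
  obtain as where as: "char_poly A = (\<Prod>a\<leftarrow>as. [:- a, 1:])" "length as = n"
    using char_poly_factorized[OF A] by blast
  obtain U where U: "U \<in> carrier_mat n n" "mat_adjoint U * A * U = mat_diag n (\<lambda>k. as ! k)"
    using hermitian_spectral_decomposition[OF A herm as(1)] by blast
  have H: "hermitian_mat (mat_diag n (\<lambda>k. as ! k))"
    using hermitian_mat_congruence[OF herm A U(1)] by (simp add: U(2))
  have "as ! k \<in> \<real>" if "k < n" for k
    using hermitian_mat_index[OF H mat_diag_dim that that] that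
    by (simp add: mat_diag_def Reals_cnj_iff)
  then show ?thesis
    using as by (auto simp: all_roots_real_def poly_prod_list prod_list_zero_iff in_set_conv_nth)
qed

section \<open>Interlacing for compressions and for principal submatrices\<close>

text \<open>Any isometry \<open>E\<close> from dimension \<open>m\<close> to \<open>Suc m\<close>
  will do; deleting a row and a column is the case of a coordinate embedding.\<close>

theorem compression_interlace:
  fixes A E :: "complex mat"
  assumes A: "A \<in> carrier_mat (Suc m) (Suc m)" and herm: "hermitian_mat A"
    and E: "E \<in> carrier_mat (Suc m) m" "mat_adjoint E * E = 1\<^sub>m m"
  shows "eigenvalues_interlace (mat_adjoint E * A * E) A"
proof -
  define B where "B = mat_adjoint E * A * E"
  have B: "B \<in> carrier_mat m m" using A E unfolding B_def by auto
  have hermB: "hermitian_mat B"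
    unfolding B_def by (rule hermitian_mat_congruence[OF herm A E(1)])
  obtain as where as: "char_poly A = (\<Prod>a\<leftarrow>as. [:- a, 1:])" "length as = Suc m"
    using char_poly_factorized[OF A] by blast
  obtain bs where bs: "char_poly B = (\<Prod>b\<leftarrow>bs. [:- b, 1:])" "length bs = m"
    using char_poly_factorized[OF B] by blast
  obtain U where U: "U \<in> carrier_mat (Suc m) (Suc m)" "mat_adjoint U * U = 1\<^sub>m (Suc m)"
    "mat_adjoint U * A * U = mat_diag (Suc m) (\<lambda>k. as ! k)"
    using hermitian_spectral_decomposition[OF A herm as(1)] by blast
  obtain V where V: "V \<in> carrier_mat m m" "mat_adjoint V * V = 1\<^sub>m m"
    "mat_adjoint V * (mat_adjoint E * A * E) * V = mat_diag m (\<lambda>k. bs ! k)"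
    using hermitian_spectral_decomposition[OF B hermB bs(1)] by (auto simp: B_def)
  define r s where "r = sorted_real_roots (char_poly A)" and "s = sorted_real_roots (char_poly B)"
  have r: "r ! j \<le> t \<longleftrightarrow> j < card {k. k < Suc m \<and> Re (as ! k) \<le> t}" if "j < Suc m" for j t
    using that sorted_nth_le_iff_card[of j as t] by (simp add: r_def as sorted_real_roots_linear_factors)
  have s: "s ! j \<le> t \<longleftrightarrow> j < card {k. k < m \<and> Re (bs ! k) \<le> t}" if "j < m" for j t
    using that sorted_nth_le_iff_card[of j bs t] by (simp add: s_def bs sorted_real_roots_linear_factors)
  note count = compression_eigenvalue_count[OF A E U V]
  \<comment> \<open>At \<open>t = s ! j\<close> the compression has more than \<open>j\<close>
    eigenvalues up to \<open>t\<close>, hence so does \<open>A\<close>.\<close>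
  have "r ! j \<le> s ! j" if "j < m" for j
    using count(1)[of "s ! j"] s[OF that, of "s ! j"] r[of j "s ! j"] that by linarith
  \<comment> \<open>At \<open>t = r ! Suc j\<close> the matrix \<open>A\<close> has more than
    \<open>Suc j\<close> eigenvalues up to \<open>t\<close>; the compression has at most one fewer,
    so still more than \<open>j\<close>.\<close>
  moreover have "s ! j \<le> r ! Suc j" if "j < m" for j
    using count(2)[of "r ! Suc j"] r[of "Suc j" "r ! Suc j"] s[OF that, of "r ! Suc j"] that by linarith
  ultimately show ?thesis
    using all_roots_real_hermitian[OF A herm] all_roots_real_hermitian[OF B hermB]
      degree_monic_char_poly[OF A] degree_monic_char_poly[OF B]
    by (simp add: eigenvalues_interlace_def interlace_def r_def s_def flip: B_def)
qed

text \<open>Deleting row and column \<open>i\<close> is compression to the coordinate hyperplane of vectors vanishing at \<open>i\<close>.\<close>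

lemma mat_delete_compression:
  fixes A :: "complex mat"
  assumes A: "A \<in> carrier_mat (Suc m) (Suc m)" and i: "i < Suc m"
  defines "E \<equiv> mat (Suc m) m (\<lambda>(k, j). if k = insert_index i j then 1 else 0)"
  shows "mat_adjoint E * E = 1\<^sub>m m" and "mat_adjoint E * A * E = mat_delete A i i"
proof -
  have ins: "insert_index i j < Suc m" if "j < m" for j
    using that by (simp add: insert_index_def)
  have inj: "insert_index i j = insert_index i k \<longleftrightarrow> j = k" for j k
    by (metis delete_insert_index)
  have E: "E \<in> carrier_mat (Suc m) m" by (simp add: E_def)
  \<comment> \<open>The map \<open>insert_index i\<close> enumerates the indices other than
    \<open>i\<close> in order, so the adjoint of \<open>E\<close> on the left selects rows; below,
    \<open>E\<close> on the right selects columns.\<close>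
  have left: "mat_adjoint E * X = mat m l (\<lambda>(j, k). X $$ (insert_index i j, k))"
    if X: "X \<in> carrier_mat (Suc m) l" for X l
  proof (rule eq_matI, goal_cases)
    case (1 j k)
    then have jk: "j < m" "k < l" by auto
    then have "(mat_adjoint E * X) $$ (j, k) = (\<Sum>h<Suc m. cnj (E $$ (h, j)) * X $$ (h, k))"
      using X E by (simp add: scalar_prod_def atLeast0LessThan del: sum.lessThan_Suc)
    also have "\<dots> = (\<Sum>h<Suc m. if h = insert_index i j then X $$ (h, k) else 0)"
      using jk by (intro sum.cong) (auto simp: E_def)
    finally show ?case using ins jk by (simp del: sum.lessThan_Suc)
  qed (use X E in auto)
  have right: "X * E = mat l m (\<lambda>(j, k). X $$ (j, insert_index i k))"
    if X: "X \<in> carrier_mat l (Suc m)" for X l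
  proof (rule eq_matI, goal_cases)
    case (1 j k)
    then have jk: "j < l" "k < m" by auto
    then have "(X * E) $$ (j, k) = (\<Sum>h<Suc m. X $$ (j, h) * E $$ (h, k))"
      using X E by (simp add: scalar_prod_def atLeast0LessThan del: sum.lessThan_Suc)
    also have "\<dots> = (\<Sum>h<Suc m. if h = insert_index i k then X $$ (j, h) else 0)"
      using jk by (intro sum.cong) (auto simp: E_def)
    finally show ?case using ins jk by (simp del: sum.lessThan_Suc)
  qed (use X E in auto)
  show "mat_adjoint E * E = 1\<^sub>m m"
    using E by (subst left[OF E]) (auto simp: E_def ins inj intro!: eq_matI)
  show "mat_adjoint E * A * E = mat_delete A i i"
    unfolding left[OF A] right[OF mat_carrier] using A i ins
    by (intro eq_matI) (auto simp: mat_delete_index[OF A i i])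
qed

theorem corollary1:
  fixes n i :: nat and A B :: "complex mat"
  assumes "n \<ge> 2"
    and "A \<in> carrier_mat n n"
    and "hermitian_mat A"
    and "i < n"
    and "B = mat_delete A i i"
  shows "eigenvalues_interlace B A"
proof -
  obtain m where n: "n = Suc m" using \<open>i < n\<close> by (cases n) auto
  note delete = mat_delete_compression[of A m i, OF assms(2,4)[unfolded n]]
  show ?thesis
    using compression_interlace[OF assms(2,3)[unfolded n] _ delete(1)]
    by (simp add: delete(2) assms(5))
qed

end
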